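(* Let $X\in\mathcal M_{\le k}$ with $\operatorname{rank}(X)=s$, $\mathcal U=\operatorname{ran}(X)$, $\mathcal V=\operatorname{ran}(X^{\mathsf T})$. Any $G\in T_X\mathcal M_{\le k}$ satisfying $\|-\nabla f(X)-G\|_{\mathsf F}=\mathrm{dist}_{\mathsf F}(-\nabla f(X),T_X\mathcal M_{\le k})$ has the form \[ G=\Pi_{T_X\mathcal M_s}(-\nabla f(X))+\Xi_{k-s}, \] where $\Xi_{k-s}$ is a best rank-$(k-s)$ approximation in the Frobenius norm (i.e. a best approximation by matrices of rank at most $k-s$) of \[ (\Pi_{\mathcal U^\perp}\otimes\Pi_{\mathcal V^\perp})(-\nabla f(X))=-\nabla f(X)-\Pi_{T_X\mathcal M_s}(-\nabla f(X)). \] Moreover, \[ g^-(X)=\|G\|_{\mathsf F}\ge\sqrt{\frac{k-s}{\min(m-s,n-s)}}\;\|\nabla f(X)\|_{\mathsf F}. \]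
   Context: Let $k\le\min(m,n)$ and $\mathcal M_{\le k}=\{X\in\mathbb R^{m\times n}:\operatorname{rank}(X)\le k\}$, $\mathcal M_s=\{X\in\mathbb R^{m\times n}:\operatorname{rank}(X)=s\}$. $\mathbb R^{m\times n}$ carries the Frobenius inner product $\langle X,Y\rangle_{\mathsf F}=\operatorname{trace}(X^{\mathsf T}Y)$, norm $\|\cdot\|_{\mathsf F}$ and distance $\mathrm{dist}_{\mathsf F}$. The function $f:\mathcal D\to\mathbb R$ is continuously differentiable and bounded below on an open set $\mathcal D\subseteq\mathbb R^{m\times n}$ with $\mathcal M_{\le k}\subset\mathcal D$; $\nabla f$ is its gradient with respect to the Frobenius inner product. Tangent cone: $T_X\mathcal M_{\le k}=\{\Xi:\exists (X_j)\subseteq\mathcal M_{\le k},\ (a_j)\subseteq\mathbb R^+,\ X_j\to X,\ a_j(X_j-X)\to\Xi\}$. $g^-(X)=\sqrt{\|\nabla f(X)\|_{\mathsf F}^2-\mathrm{dist}_{\mathsf F}(-\nabla f(X),T_X\mathcal M_{\le k})^2}$. For subspaces $\mathcal U\subseteq\mathbb R^m$, $\mathcal V\subseteq\mathbb R^n$: $\mathcal U\otimes\mathcal V$ is the space of matrices with column space in $\mathcal U$ and row space in $\mathcal V$; $\Pi_{\mathcal S}$ is the orthogonal projection onto $\mathcal S$; $(\Pi_{\mathcal U}\otimes\Pi_{\mathcal V})Z=\Pi_{\mathcal U}Z\Pi_{\mathcal V}$. For $\operatorname{rank}(X)=s$, $T_X\mathcal M_s=(\mathcal U\otimes\mathcal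 V)\oplus(\mathcal U^\perp\otimes\mathcal V)\oplus(\mathcal U\otimes\mathcal V^\perp)$ is the tangent space of the smooth manifold $\mathcal M_s$ at $X$, with orthogonal complement $\mathcal U^\perp\otimes\mathcal V^\perp$. In the degenerate case $s=k=\min(m,n)$ the quotient $0/0$ under the root is read as $0$. *)

theory Defs
  imports "HOL-Analysis.Analysis"
begin

text \<open>Matrices with \<open>m\<close> rows and \<open>n\<close> columns have type \<^typ>\<open>real^'n^'m\<close>. The inner product, norm and
  distance that this type carries in the library are the Frobenius ones:\<close>

lemma inner_eq_trace: "X \<bullet> Y = trace (transpose X ** Y)" for X Y :: "real^'n^'m"
  unfolding trace_def inner_vec_def matrix_matrix_mult_def transpose_def
  by (simp add: inner_real_def) (rule sum.swap)

lemma norm_eq_trace: "norm X = sqrt (trace (transpose X ** X))" for X :: "real^'n^'m"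
  by (simp add: norm_eq_sqrt_inner inner_eq_trace)

definition rank_le :: "nat \<Rightarrow> (real^'n^'m) set" where
  "rank_le k = {X. rank X \<le> k}"

definition tangent_cone :: "'a::real_normed_vector set \<Rightarrow> 'a \<Rightarrow> 'a set" where
  "tangent_cone M x =
     {\<xi>. \<exists>X a. (\<forall>j::nat. X j \<in> M) \<and> (\<forall>j. (a j :: real) > 0) \<and>
        X \<longlonglongrightarrow> x \<and> (\<lambda>j. a j *\<^sub>R (X j - x)) \<longlonglongrightarrow> \<xi>}"

definition mat_ran :: "real^'n^'m \<Rightarrow> (real^'m) set" where
  "mat_ran X = range (\<lambda>v. X *v v)"

definition orth_proj :: "'a::real_inner set \<Rightarrow> 'a \<Rightarrow> 'a" where
  "orth_proj S x = (THE y. y \<in> S \<and> x - y \<in> S\<^sup>\<bottom>)"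

definition tensor_space :: "(real^'m) set \<Rightarrow> (real^'n) set \<Rightarrow> (real^'n^'m) set" (infixr \<open>\<otimes>\<^sub>S\<close> 75) where
  "U \<otimes>\<^sub>S V = {Z. mat_ran Z \<subseteq> U \<and> mat_ran (transpose Z) \<subseteq> V}"

definition tensor_proj :: "(real^'m) set \<Rightarrow> (real^'n) set \<Rightarrow> real^'n^'m \<Rightarrow> real^'n^'m" where
  "tensor_proj U V Z = matrix (orth_proj U) ** Z ** matrix (orth_proj V)"

text \<open>The tangent space at \<open>X\<close> of the manifold of matrices of rank exactly \<^term>\<open>rank X\<close>. The sum is
  the elementwise sum of sets. Lemma \<open>tangent_space_eq_velocities\<close> below shows that this
  is the set of velocities at \<open>X\<close> of curves of constant rank.\<close>

definition tangent_space :: "real^'n^'m \<Rightarrow> (real^'n^'m) set" where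
  "tangent_space X =
     (let U = mat_ran X; V = mat_ran (transpose X)
      in (U \<otimes>\<^sub>S V) + (U\<^sup>\<bottom> \<otimes>\<^sub>S V) + (U \<otimes>\<^sub>S V\<^sup>\<bottom>))"

definition best_rank_approx :: "nat \<Rightarrow> real^'n^'m \<Rightarrow> real^'n^'m \<Rightarrow> bool" where
  "best_rank_approx r Z \<Xi> \<longleftrightarrow>
     \<Xi> \<in> rank_le r \<and> (\<forall>Y \<in> rank_le r. norm (Z - \<Xi>) \<le> norm (Z - Y))"

text \<open>\<open>gminus k grad X\<close> is \<open>g\<^sup>-(X)\<close> for a function with gradient field \<open>grad\<close>.\<close>

definition gminus :: "nat \<Rightarrow> (real^'n^'m \<Rightarrow> real^'n^'m) \<Rightarrow> real^'n^'m \<Rightarrow> real" where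
  "gminus k grad X =
     sqrt ((norm (grad X))\<^sup>2 - (infdist (- grad X) (tangent_cone (rank_le k) X))\<^sup>2)"

lemma orth_proj_unique:
  fixes S :: "'a::euclidean_space set"
  assumes "subspace S"
  shows "orth_proj S x = y \<longleftrightarrow> y \<in> S \<and> x - y \<in> S\<^sup>\<bottom>"
proof -
  obtain y0 where y0: "y0 \<in> S" "x - y0 \<in> S\<^sup>\<bottom>"
  proof -
    obtain y z where "y \<in> span S" "\<And>w. w \<in> span S \<Longrightarrow> orthogonal z w" "x = y + z"
      using orthogonal_subspace_decomp_exists[of S x] by metis
    then show ?thesis using that[of y] assms
      by (auto simp: orthogonal_comp_def orthogonal_commute span_eq_iff[THEN iffD2])
  qed
  have uniq: "y1 = y0" if "y1 \<in> S" "x - y1 \<in> S\<^sup>\<bottom>" for y1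
  proof -
    have "y1 - y0 \<in> S" using assms that y0 by (simp add: subspace_diff)
    moreover have "(x - y0) - (x - y1) \<in> S\<^sup>\<bottom>"
      using that y0 subspace_orthogonal_comp by (metis subspace_diff)
    ultimately have "(y1 - y0) \<bullet> (y1 - y0) = 0"
      by (auto simp: orthogonal_comp_def orthogonal_def)
    then show ?thesis by simp
  qed
  have "orth_proj S x = y0"
    unfolding orth_proj_def by (rule the_equality) (use y0 uniq in blast)+
  with uniq y0 show ?thesis by blast
qed

lemma
  fixes S :: "'a::euclidean_space set"
  assumes "subspace S"
  shows orth_proj_mem: "orth_proj S x \<in> S"
    and orth_proj_diff: "x - orth_proj S x \<in> S\<^sup>\<bottom>"
  using orth_proj_unique[OF assms, of x "orth_proj S x"] by auto

lemma orth_proj_linear: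
  fixes S :: "'a::euclidean_space set"
  assumes "subspace S"
  shows "linear (orth_proj S)"
proof (rule linearI)
  note m = orth_proj_mem[OF assms] and d = orth_proj_diff[OF assms]
  fix x y :: 'a and c :: real
  have "(x - orth_proj S x) + (y - orth_proj S y) \<in> S\<^sup>\<bottom>"
    by (intro subspace_add subspace_orthogonal_comp d)
  then show "orth_proj S (x + y) = orth_proj S x + orth_proj S y"
    by (subst orth_proj_unique[OF assms]) (auto simp: algebra_simps intro: subspace_add assms m)
  have "c *\<^sub>R (x - orth_proj S x) \<in> S\<^sup>\<bottom>"
    by (intro subspace_scale subspace_orthogonal_comp d)
  then show "orth_proj S (c *\<^sub>R x) = c *\<^sub>R orth_proj S x"
    by (subst orth_proj_unique[OF assms]) (auto simp: algebra_simps intro: subspace_scale assms m)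
qed

lemma orth_proj_self_adjoint:
  fixes S :: "'a::euclidean_space set"
  assumes "subspace S"
  shows "orth_proj S x \<bullet> y = x \<bullet> orth_proj S y"
proof -
  note m = orth_proj_mem[OF assms] and d = orth_proj_diff[OF assms]
  have "orth_proj S x \<bullet> (y - orth_proj S y) = 0" "orth_proj S y \<bullet> (x - orth_proj S x) = 0"
    using m[of x] d[of y] m[of y] d[of x] by (auto simp: orthogonal_comp_def orthogonal_def)
  then show ?thesis by (simp add: algebra_simps inner_commute)
qed

lemma orth_proj_matrix_apply:
  "subspace S \<Longrightarrow> matrix (orth_proj S) *v x = orth_proj S x" for S :: "(real^'a) set"
  by (simp add: matrix_works orth_proj_linear)

lemma orth_proj_matrix_transpose:
  fixes S :: "(real^'a) set"
  assumes "subspace S"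
  shows "transpose (matrix (orth_proj S)) = matrix (orth_proj S)"
proof -
  have "adjoint (orth_proj S) = orth_proj S"
    by (rule adjoint_unique) (simp add: orth_proj_self_adjoint assms)
  then show ?thesis
    using matrix_adjoint[OF orth_proj_linear[OF assms]] by simp
qed

lemma matrix_add_rdistrib: "(A + B) ** C = A ** C + B ** C"
  for A B :: "real^'n^'m" and C :: "real^'p^'n"
  by (vector matrix_matrix_mult_def sum.distrib[symmetric] field_simps)

lemma matrix_diff_rdistrib: "(A - B) ** C = A ** C - B ** C"
  for A B :: "real^'n^'m" and C :: "real^'p^'n"
  using matrix_add_rdistrib[of "A - B" B C] by simp

lemma matrix_diff_ldistrib: "C ** (A - B) = C ** A - C ** B"
  for A B :: "real^'n^'m" and C :: "real^'m^'p"
  using matrix_add_ldistrib[of C "A - B" B] by simp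

lemma subspace_mat_ran: "subspace (mat_ran X)"
  unfolding mat_ran_def by (rule linear_subspace_image) auto

lemma mat_ran_subset_imp_factor:
  fixes X :: "real^'n^'m" and Z :: "real^'p^'m"
  assumes "mat_ran Z \<subseteq> mat_ran X"
  shows "\<exists>B. Z = X ** B"
proof -
  have "\<forall>j. \<exists>b. X *v b = Z *v axis j 1"
    using assms unfolding mat_ran_def by (metis rangeE rangeI subsetD)
  then obtain b where b: "X *v b j = Z *v axis j 1" for j by metis
  have "Z = X ** (\<chi> i j. b j $ i)"
  proof (simp add: vec_eq_iff, intro allI)
    fix i j
    have "Z $ i $ j = (Z *v axis j 1) $ i" by (simp add: matrix_vector_mult_basis column_def)
    also have "\<dots> = (X *v b j) $ i" by (simp add: b)
    also have "\<dots> = (X ** (\<chi> i j. b j $ i)) $ i $ j"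
      by (simp add: matrix_vector_mult_def matrix_matrix_mult_def)
    finally show "Z $ i $ j = (X ** (\<chi> i j. b j $ i)) $ i $ j" .
  qed
  then show ?thesis ..
qed

lemma tangent_space_imp_factor:
  assumes "Z \<in> tangent_space X"
  shows "\<exists>A B. Z = A ** X + X ** B"
proof -
  obtain Z1 Z2 Z3 where Z: "Z = Z1 + Z2 + Z3" and
    r: "mat_ran Z1 \<subseteq> mat_ran X" "mat_ran (transpose Z2) \<subseteq> mat_ran (transpose X)" "mat_ran Z3 \<subseteq> mat_ran X"
    using assms by (auto simp: tangent_space_def tensor_space_def Let_def set_plus_def)
  obtain B1 C B3 where "Z1 = X ** B1" "transpose Z2 = transpose X ** C" "Z3 = X ** B3"
    using r mat_ran_subset_imp_factor by metis
  moreover have "Z2 = transpose C ** X"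
    using \<open>transpose Z2 = transpose X ** C\<close>
    by (metis matrix_transpose_mul transpose_transpose)
  ultimately have "Z = transpose C ** X + X ** (B1 + B3)"
    by (simp add: Z matrix_add_ldistrib)
  then show ?thesis by blast
qed

lemma bilinear_zero_imp_tangent_space:
  fixes X Z :: "real^'n^'m"
  assumes "\<And>u v. u \<in> (mat_ran X)\<^sup>\<bottom> \<Longrightarrow> v \<in> (mat_ran (transpose X))\<^sup>\<bottom> \<Longrightarrow> u \<bullet> (Z *v v) = 0"
  shows "Z \<in> tangent_space X"
proof -
  define U V where "U = mat_ran X" and "V = mat_ran (transpose X)"
  define P Q where "P = matrix (orth_proj U)" and "Q = matrix (orth_proj V)"
  have sU: "subspace U" and sV: "subspace V" by (simp_all add: U_def V_def subspace_mat_ran)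
  have P: "P *v x = orth_proj U x" "transpose P = P" for x
    by (simp_all add: P_def sU orth_proj_matrix_apply orth_proj_matrix_transpose)
  have Q: "Q *v x = orth_proj V x" "transpose Q = Q" for x
    by (simp_all add: Q_def sV orth_proj_matrix_apply orth_proj_matrix_transpose)
  have PU: "P *v x \<in> U" "(mat 1 - P) *v x \<in> U\<^sup>\<bottom>" for x
    using orth_proj_mem[OF sU] orth_proj_diff[OF sU]
    by (auto simp: P matrix_vector_mult_diff_rdistrib)
  have QV: "Q *v x \<in> V" "(mat 1 - Q) *v x \<in> V\<^sup>\<bottom>" for x
    using orth_proj_mem[OF sV] orth_proj_diff[OF sV]
    by (auto simp: Q matrix_vector_mult_diff_rdistrib)
  have tr: "transpose (mat 1 - P) = mat 1 - P" "transpose (mat 1 - Q) = mat 1 - Q"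
    using P(2) Q(2) by (simp_all add: transpose_def vec_eq_iff mat_def eq_commute)
  have zero: "(mat 1 - P) ** Z ** (mat 1 - Q) = 0"
  proof -
    have "x \<bullet> ((mat 1 - P) ** Z ** (mat 1 - Q) *v y) = 0" for x y
    proof -
      have "x \<bullet> ((mat 1 - P) ** Z ** (mat 1 - Q) *v y)
          = ((mat 1 - P) *v x) \<bullet> (Z *v ((mat 1 - Q) *v y))"
        by (metis dot_lmul_matrix matrix_vector_mul_assoc tr(1) transpose_matrix_vector)
      also have "\<dots> = 0" using PU(2) QV(2) assms by (simp add: U_def V_def)
      finally show ?thesis .
    qed
    then show ?thesis by (metis inner_eq_zero_iff matrix_eq matrix_vector_mult_0)
  qed
  have mem: "A ** Z ** B \<in> S \<otimes>\<^sub>S T"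
    if "\<And>x. A *v x \<in> S" "\<And>x. B *v x \<in> T" "transpose B = B" for A B S T
  proof -
    have "transpose (A ** Z ** B) *v y \<in> T" for y
      using that(2)[of "transpose (A ** Z) *v y"]
      by (simp only: matrix_transpose_mul[of "A ** Z"] that(3) matrix_vector_mul_assoc)
    moreover have "A ** Z ** B *v y \<in> S" for y
      using that(1)[of "Z ** B *v y"] by (simp only: matrix_vector_mul_assoc matrix_mul_assoc)
    ultimately show ?thesis unfolding tensor_space_def mat_ran_def by blast
  qed
  have "Z = P ** Z ** Q + (mat 1 - P) ** Z ** Q + P ** Z ** (mat 1 - Q)
          + (mat 1 - P) ** Z ** (mat 1 - Q)"
    by (simp add: matrix_diff_ldistrib matrix_diff_rdistrib)
  then have "Z = P ** Z ** Q + (mat 1 - P) ** Z ** Q + P ** Z ** (mat 1 - Q)"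
    by (simp add: zero)
  moreover have "\<dots> \<in> (U \<otimes>\<^sub>S V) + (U\<^sup>\<bottom> \<otimes>\<^sub>S V) + (U \<otimes>\<^sub>S V\<^sup>\<bottom>)"
    by (intro set_plus_intro mem PU QV Q tr)
  ultimately show ?thesis by (simp add: tangent_space_def Let_def U_def V_def)
qed

lemma norm_matrix_vector_mult_le: "norm (A *v x) \<le> norm A * norm x" for A :: "real^'n^'m"
proof -
  have "norm (A *v x) \<le> L2_set (\<lambda>i. norm (A $ i) * norm x) UNIV"
    unfolding norm_vec_def[of "A *v x"]
    by (rule L2_set_mono) (simp_all add: matrix_vector_mul_component Cauchy_Schwarz_ineq2)
  also have "\<dots> = norm A * norm x"
    by (simp add: norm_vec_def[of A] L2_set_left_distrib)
  finally show ?thesis .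
qed

lemma velocity_bilinear_zero:
  fixes X Z :: "real^'n^'m" and \<gamma> :: "real \<Rightarrow> real^'n^'m"
  assumes g0: "\<gamma> 0 = X" and rk: "\<forall>\<^sub>F t in at 0. rank (\<gamma> t) = rank X"
    and der: "(\<gamma> has_vector_derivative Z) (at 0)"
    and u: "u \<in> (mat_ran X)\<^sup>\<bottom>" and v: "v \<in> (mat_ran (transpose X))\<^sup>\<bottom>"
  shows "u \<bullet> (Z *v v) = 0"
proof -
  define V where "V = mat_ran (transpose X)"
  define D where "D t = (1 / t) *\<^sub>R (\<gamma> t - X)" for t
  have sV: "subspace V" by (simp add: V_def subspace_mat_ran)
  have ker: "X *v w = 0 \<longleftrightarrow> w \<in> V\<^sup>\<bottom>" for w
  proof -
    have "w \<in> V\<^sup>\<bottom> \<longleftrightarrow> (\<forall>y. y \<bullet> (X *v w) = 0)"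
      by (simp add: V_def mat_ran_def orthogonal_comp_def orthogonal_def dot_lmul_matrix)
    then show ?thesis by (metis inner_eq_zero_iff inner_zero_right)
  qed
  have "\<forall>w\<in>V. X *v w = 0 \<longrightarrow> w = 0"
    using ker by (auto simp: orthogonal_comp_def orthogonal_def)
  then obtain c where c: "c > 0" "\<And>w. w \<in> V \<Longrightarrow> c * norm w \<le> norm (X *v w)"
    using injective_imp_isometric[of V "(*v) X"] sV closed_subspace[OF sV] by auto
  have Xv: "X *v v = 0" using v by (simp add: ker V_def)
  have uX: "u \<bullet> (X *v w) = 0" for w
    using u by (auto simp: orthogonal_comp_def orthogonal_def mat_ran_def inner_commute)
  have lim: "(\<gamma> \<longlongrightarrow> X) (at 0)"
    using has_vector_derivative_continuous[OF der] g0 by (simp add: continuous_within)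
  have Dlim: "(D \<longlongrightarrow> Z) (at 0)"
  proof -
    have "((\<lambda>h. norm (\<gamma> h - X - h *\<^sub>R Z) / norm h) \<longlongrightarrow> 0) (at 0)"
      using der g0 by (simp add: has_vector_derivative_def has_derivative_at)
    moreover have "\<forall>\<^sub>F h in at 0. norm (\<gamma> h - X - h *\<^sub>R Z) / norm h = norm (D h - Z)"
      unfolding eventually_at_filter
    proof (rule always_eventually, intro allI impI)
      fix h :: real assume "h \<noteq> 0"
      then have "D h - Z = (1 / h) *\<^sub>R (\<gamma> h - X - h *\<^sub>R Z)"
        by (simp add: D_def algebra_simps)
      then show "norm (\<gamma> h - X - h *\<^sub>R Z) / norm h = norm (D h - Z)" by simp
    qed
    ultimately have "((\<lambda>h. norm (D h - Z)) \<longlongrightarrow> 0) (at 0)"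
      by (rule Lim_transform_eventually)
    then show ?thesis by (simp add: LIM_zero_iff tendsto_norm_zero_iff)
  qed
  have small: "\<forall>\<^sub>F t in at 0. norm (\<gamma> t - X) < c / 2"
    using tendstoD[OF lim, of "c / 2"] c(1) by (simp add: dist_norm)
  have bound: "\<forall>\<^sub>F t in at 0. norm (u \<bullet> (D t *v v)) \<le>
      norm u * (norm (D t) * (2 / c * (norm (\<gamma> t - X) * norm v)))"
    using small rk
  proof eventually_elim
    case (elim t)
    have low: "c / 2 * norm w \<le> norm (\<gamma> t *v w)" if "w \<in> V" for w
    proof -
      have "norm (X *v w) \<le> norm (\<gamma> t *v w) + norm ((\<gamma> t - X) *v w)"
        using norm_triangle_ineq4[of "\<gamma> t *v w" "(\<gamma> t - X) *v w"]
        by (simp add: matrix_vector_mult_diff_rdistrib)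
      moreover have "norm ((\<gamma> t - X) *v w) \<le> c / 2 * norm w"
        using order_trans[OF norm_matrix_vector_mult_le mult_right_mono[OF less_imp_le[OF elim(1)]]]
        by simp
      ultimately show ?thesis using c(2)[OF that] by simp
    qed
    have "inj_on ((*v) (\<gamma> t)) V"
    proof (rule inj_onI)
      fix x y assume xy: "x \<in> V" "y \<in> V" "\<gamma> t *v x = \<gamma> t *v y"
      then have "c / 2 * norm (x - y) \<le> 0"
        using low[of "x - y"] sV by (simp add: subspace_diff matrix_vector_mult_diff_distrib)
      then show "x = y" using c(1) by (simp add: mult_le_0_iff)
    qed
    then have "dim ((*v) (\<gamma> t) ` V) = dim V"
      using sV by (intro dim_image_eq) (auto simp: span_eq_iff[THEN iffD2])
    also have "\<dots> = dim (range ((*v) (\<gamma> t)))"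
      using elim(2) rank_dim_range[of "transpose X"] rank_dim_range[of "\<gamma> t"]
      by (simp add: V_def mat_ran_def rank_transpose)
    finally have "(*v) (\<gamma> t) ` V = range ((*v) (\<gamma> t))"
      by (intro subspace_dim_equal linear_subspace_image sV) auto
    then obtain w where w: "w \<in> V" "\<gamma> t *v v = \<gamma> t *v w" by blast
    have "c / 2 * norm w \<le> norm ((\<gamma> t - X) *v v)"
      using low[OF w(1)] w(2) Xv by (simp add: matrix_vector_mult_diff_rdistrib)
    also have "\<dots> \<le> norm (\<gamma> t - X) * norm v" by (rule norm_matrix_vector_mult_le)
    finally have nw: "norm w \<le> 2 / c * (norm (\<gamma> t - X) * norm v)"
      using c(1) by (simp add: field_simps)
    have "u \<bullet> (D t *v v) = u \<bullet> (D t *v w)"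
      using w(2) uX
      by (simp add: D_def scaleR_matrix_vector_assoc[symmetric] matrix_vector_mult_diff_rdistrib
          inner_diff_right)
    also have "norm \<dots> \<le> norm u * norm (D t *v w)" using Cauchy_Schwarz_ineq2 by simp
    also have "\<dots> \<le> norm u * (norm (D t) * norm w)"
      by (intro mult_left_mono norm_matrix_vector_mult_le) auto
    also have "\<dots> \<le> norm u * (norm (D t) * (2 / c * (norm (\<gamma> t - X) * norm v)))"
      by (intro mult_left_mono nw) auto
    finally show ?case .
  qed
  have "((\<lambda>t. norm u * (norm (D t) * (2 / c * (norm (\<gamma> t - X) * norm v)))) \<longlongrightarrow>
      norm u * (norm Z * (2 / c * (norm (X - X) * norm v)))) (at 0)"
    by (intro tendsto_intros Dlim lim)
  then have "((\<lambda>t. u \<bullet> (D t *v v)) \<longlongrightarrow> 0) (at 0)"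
    using bound by (intro Lim_null_comparison[OF bound]) simp
  moreover have "((\<lambda>t. u \<bullet> (D t *v v)) \<longlongrightarrow> u \<bullet> (Z *v v)) (at 0)"
  proof -
    have "bounded_linear (\<lambda>A::real^'n^'m. A *v v)"
      by (intro linear_conv_bounded_linear[THEN iffD1] linearI)
        (simp_all add: matrix_vector_mult_add_rdistrib scaleR_matrix_vector_assoc)
    from bounded_linear.tendsto[OF this Dlim] show ?thesis by (rule tendsto_inner[OF tendsto_const])
  qed
  ultimately have "0 = u \<bullet> (Z *v v)" by (rule LIM_unique)
  then show ?thesis by simp
qed

lemma factor_imp_velocity:
  fixes X :: "real^'n^'m"
  shows "\<exists>\<gamma>. \<gamma> 0 = X \<and> (\<forall>\<^sub>F t in at 0. rank (\<gamma> t) = rank X) \<and>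
     (\<gamma> has_vector_derivative (A ** X + X ** B)) (at 0)"
proof -
  define \<gamma> where "\<gamma> t = (mat 1 + t *\<^sub>R A) ** X ** (mat 1 + t *\<^sub>R B)" for t :: real
  have rank1: "rank ((mat 1 + C) ** Y) = rank Y"
    if "norm C < 1" for C :: "real^'p^'p" and Y :: "real^'q^'p"
  proof -
    have "inj ((*v) (mat 1 + C))"
    proof (rule injI)
      fix x y assume "(mat 1 + C) *v x = (mat 1 + C) *v y"
      then have "x - y = - (C *v (x - y))"
        by (simp add: matrix_vector_mult_add_rdistrib matrix_vector_mult_diff_distrib algebra_simps)
      then have "norm (x - y) \<le> norm C * norm (x - y)"
        by (metis norm_matrix_vector_mult_le norm_minus_cancel)
      then show "x = y" using that by (simp add: mult_le_cancel_right1)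
    qed
    then have "dim ((*v) (mat 1 + C) ` range ((*v) Y)) = dim (range ((*v) Y))"
      by (intro dim_image_eq) (auto intro: inj_on_subset)
    then show ?thesis by (simp add: rank_dim_range image_image matrix_vector_mul_assoc)
  qed
  have lim: "\<forall>\<^sub>F t in at 0. norm (t *\<^sub>R C) < 1" for C :: "real^'p^'p"
  proof -
    have "((\<lambda>t. norm (t *\<^sub>R C)) \<longlongrightarrow> norm (0 *\<^sub>R C)) (at 0)" by (intro tendsto_intros)
    then show ?thesis by (rule order_tendstoD) simp
  qed
  have "\<forall>\<^sub>F t in at 0. rank (\<gamma> t) = rank X"
    using lim[of A] lim[of "transpose B"]
  proof eventually_elim
    case (elim t)
    have tr: "transpose (mat 1 + t *\<^sub>R B) = mat 1 + t *\<^sub>R transpose B"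
      by (auto simp: transpose_def vec_eq_iff mat_def)
    have "rank (\<gamma> t) = rank ((mat 1 + t *\<^sub>R A) ** (X ** (mat 1 + t *\<^sub>R B)))"
      by (simp add: \<gamma>_def matrix_mul_assoc)
    also have "\<dots> = rank (transpose (X ** (mat 1 + t *\<^sub>R B)))"
      using elim by (simp add: rank1 rank_transpose)
    also have "transpose (X ** (mat 1 + t *\<^sub>R B)) = (mat 1 + t *\<^sub>R transpose B) ** transpose X"
      by (subst matrix_transpose_mul) (simp add: tr)
    finally show ?case using elim by (simp add: rank1 rank_transpose)
  qed
  moreover have "\<gamma> = (\<lambda>t. X + t *\<^sub>R (A ** X + X ** B) + t\<^sup>2 *\<^sub>R (A ** X ** B))"
  proof
    have s: "(t *\<^sub>R C) ** D = t *\<^sub>R (C ** D)" "C ** (t *\<^sub>R D) = t *\<^sub>R (C ** D)"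
      for C :: "real^'q^'p" and D :: "real^'r^'q" and t :: real
      by (simp_all add: matrix_matrix_mult_def vec_eq_iff sum_distrib_left mult_ac)
    show "\<gamma> t = X + t *\<^sub>R (A ** X + X ** B) + t\<^sup>2 *\<^sub>R (A ** X ** B)" for t
      by (simp add: \<gamma>_def matrix_add_ldistrib matrix_add_rdistrib s algebra_simps power2_eq_square)
  qed
  then have "(\<gamma> has_vector_derivative (A ** X + X ** B)) (at 0)"
    unfolding has_vector_derivative_def by (auto intro!: derivative_eq_intros)
  ultimately show ?thesis by (intro exI[of _ \<gamma>]) (simp add: \<gamma>_def)
qed

lemma tangent_space_eq_velocities:
  "tangent_space X =
     {Z. \<exists>\<gamma>. \<gamma> 0 = X \<and> (\<forall>\<^sub>F t in at 0. rank (\<gamma> t) = rank X) \<and> (\<gamma> has_vector_derivative Z) (at 0)}"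
  (is "_ = ?R")
proof
  show "tangent_space X \<subseteq> ?R"
    using tangent_space_imp_factor factor_imp_velocity by fast
  show "?R \<subseteq> tangent_space X"
    using bilinear_zero_imp_tangent_space velocity_bilinear_zero by blast
qed

end

theory Submission
  imports Defs
begin

text \<open>Write \<open>U\<close> and \<open>V\<close> for the column space and the row space of \<open>X\<close>, \<open>s\<close> for its rank, and \<open>N\<close> for
  the orthogonal projection onto \<open>U\<^sup>\<bottom> \<otimes> V\<^sup>\<bottom>\<close>. The projection \<open>N\<close> controls the whole geometry at \<open>X\<close>:
  the tangent space of the matrices of rank \<open>s\<close> is the kernel of \<open>N\<close> (\<open>tangent_space_eq_kernel\<close>),
  and the tangent cone of the matrices of rank at most \<open>k\<close> consists of all \<open>G\<close> for which \<open>N G\<close> has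
  rank at most \<open>k - s\<close> (\<open>tangent_cone_rank_le\<close>). The cone is therefore the orthogonal sum of a
  linear space and of the set of matrices of rank at most \<open>k - s\<close> in \<open>U\<^sup>\<bottom> \<otimes> V\<^sup>\<bottom>\<close>.

  To project \<open>Z\<close>, here the negative gradient, onto the cone one copies the tangential part \<open>Z - N Z\<close>
  and approximates \<open>N Z\<close> as well as possible by a matrix of rank at most \<open>k - s\<close>. It makes no difference
  whether the competitors in this approximation are confined to \<open>U\<^sup>\<bottom> \<otimes> V\<^sup>\<bottom>\<close>, because \<open>N\<close> neither
  raises the rank nor increases the norm. The cone is invariant under scaling, so the line through a
  closest point \<open>G\<close> stays in it, \<open>Z - G\<close> is orthogonal to \<open>G\<close>, and Pythagoras gives
  \<open>\<parallel>Z\<parallel>\<^sup>2 - dist\<^sup>2 = \<parallel>G\<parallel>\<^sup>2\<close> (\<open>tangent_cone_projection\<close>).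

  The lower bound needs one good approximation of \<open>N Z\<close>, not the best one. In an orthonormal basis of
  \<open>V\<^sup>\<bottom>\<close> the matrix \<open>N Z\<close> has \<open>n - s\<close> columns, and the \<open>k - s\<close> longest of them carry at least the
  fraction \<open>(k - s)/(n - s)\<close> of the squared norm; keeping these alone is an approximation of rank at
  most \<open>k - s\<close>. Rows in a basis of \<open>U\<^sup>\<bottom>\<close> give the fraction \<open>(k - s)/(m - s)\<close>, and the better of the two
  has the minimum in the denominator (\<open>infdist_tangent_cone_le\<close>).\<close>

section \<open>Matrices of bounded rank\<close>

lemma tendsto_matrix_matrix_mult [tendsto_intros]:
  fixes A :: "'a \<Rightarrow> real^'n^'m" and B :: "'a \<Rightarrow> real^'p^'n"
  assumes "(A \<longlongrightarrow> A0) F" and "(B \<longlongrightarrow> B0) F"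
  shows "((\<lambda>x. A x ** B x) \<longlongrightarrow> A0 ** B0) F"
  unfolding matrix_matrix_mult_def
  by (intro tendsto_vec_lambda tendsto_sum tendsto_mult tendsto_vec_nth assms)

lemma matrix_scaleR_ldistrib: "(c *\<^sub>R A) ** B = c *\<^sub>R (A ** B)"
  for A :: "real^'n^'m" and B :: "real^'p^'n"
  by (simp add: matrix_matrix_mult_def vec_eq_iff sum_distrib_left mult_ac)

lemma matrix_scaleR_rdistrib: "A ** (c *\<^sub>R B) = c *\<^sub>R (A ** B)"
  for A :: "real^'n^'m" and B :: "real^'p^'n"
  by (simp add: matrix_matrix_mult_def vec_eq_iff sum_distrib_left mult_ac)

lemma norm_transpose: "norm (transpose A) = norm A" for A :: "real^'n^'m"
  using trace_mul_sym[of A "transpose A"] by (simp add: norm_eq_trace)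

lemma dim_mat_ran: "dim (mat_ran A) = rank A"
  by (simp add: mat_ran_def rank_dim_range)

lemma rank_add_le: "rank (A + B) \<le> rank A + rank B" for A B :: "real^'n^'m"
proof -
  have "mat_ran (A + B) \<subseteq> {x + y |x y. x \<in> mat_ran A \<and> y \<in> mat_ran B}"
    by (force simp: mat_ran_def matrix_vector_mult_add_rdistrib)
  then have "dim (mat_ran (A + B)) \<le> dim {x + y |x y. x \<in> mat_ran A \<and> y \<in> mat_ran B}"
    by (rule dim_subset)
  also have "\<dots> \<le> dim (mat_ran A) + dim (mat_ran B)"
    using dim_sums_Int[OF subspace_mat_ran[of A] subspace_mat_ran[of B]] by linarith
  finally show ?thesis by (simp add: dim_mat_ran)
qed

lemma rank_scaleR_le: "rank (c *\<^sub>R A) \<le> rank A" for A :: "real^'n^'m"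
proof -
  have "c *\<^sub>R A = (c *\<^sub>R mat 1) ** A" by (simp add: matrix_scaleR_ldistrib)
  then show ?thesis by (metis rank_mul_le_right)
qed

lemma mat_ran_transpose_orthogonal_comp:
  "v \<in> (mat_ran (transpose X))\<^sup>\<bottom> \<longleftrightarrow> X *v v = 0" for X :: "real^'n^'m"
proof -
  have "v \<in> (mat_ran (transpose X))\<^sup>\<bottom> \<longleftrightarrow> (\<forall>y. y \<bullet> (X *v v) = 0)"
    by (simp add: mat_ran_def orthogonal_comp_def orthogonal_def dot_lmul_matrix)
  then show ?thesis by (metis inner_eq_zero_iff inner_zero_right)
qed

lemma mem_orthogonal_comp_imp_0: "x \<in> S \<Longrightarrow> x \<in> S\<^sup>\<bottom> \<Longrightarrow> x = 0" for x :: "'a::euclidean_space"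
  by (auto simp: orthogonal_comp_def orthogonal_def)

lemma dim_orthogonal_comp:
  fixes S :: "'a::euclidean_space set"
  assumes "subspace S"
  shows "dim (S\<^sup>\<bottom>) + dim S = DIM('a)"
proof -
  have "S\<^sup>\<bottom> = {y \<in> UNIV. \<forall>x\<in>S. orthogonal x y}"
    by (auto simp: orthogonal_comp_def orthogonal_commute)
  then show ?thesis using dim_subspace_orthogonal_to_vectors[OF assms subspace_UNIV] by simp
qed

text \<open>On its row space a matrix stretches every vector by a factor of at least some \<open>c > 0\<close>. Perturbed by less than
  \<open>c\<close> in norm it is still injective there, so the rank cannot drop near a matrix.\<close>

lemma closed_rank_le: "closed (rank_le k :: (real^'n^'m) set)"
proof (unfold closed_sequential_limits, intro allI impI, elim conjE)
  fix A :: "nat \<Rightarrow> real^'n^'m" and B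
  assume A: "\<forall>j. A j \<in> rank_le k" and lim: "A \<longlonglongrightarrow> B"
  define W where "W = mat_ran (transpose B)"
  have sW: "subspace W" by (simp add: W_def subspace_mat_ran)
  have "\<forall>w\<in>W. B *v w = 0 \<longrightarrow> w = 0"
    using mem_orthogonal_comp_imp_0[of _ W] mat_ran_transpose_orthogonal_comp[of _ B]
    by (auto simp: W_def)
  then obtain c where c: "c > 0" "\<And>w. w \<in> W \<Longrightarrow> c * norm w \<le> norm (B *v w)"
    using injective_imp_isometric[of W "(*v) B"] sW closed_subspace[OF sW] by auto
  obtain j where j: "norm (A j - B) < c"
    using tendstoD[OF lim c(1)] by (auto simp: dist_norm eventually_sequentially)
  have "inj_on ((*v) (A j)) W"
  proof (rule inj_onI)
    fix x y assume xy: "x \<in> W" "y \<in> W" "A j *v x = A j *v y"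
    then have "B *v (x - y) = - ((A j - B) *v (x - y))"
      by (simp add: matrix_vector_mult_diff_rdistrib matrix_vector_mult_diff_distrib)
    then have "c * norm (x - y) \<le> norm (A j - B) * norm (x - y)"
      using c(2)[of "x - y"] subspace_diff[OF sW xy(1,2)]
        norm_matrix_vector_mult_le[of "A j - B" "x - y"] by simp
    then show "x = y" using j by (simp add: mult_le_cancel_right)
  qed
  then have "dim ((*v) (A j) ` W) = dim W"
    using sW by (intro dim_image_eq) (auto simp: span_eq_iff[THEN iffD2])
  moreover have "dim ((*v) (A j) ` W) \<le> dim (mat_ran (A j))"
    by (intro dim_subset) (auto simp: mat_ran_def)
  ultimately have "rank B \<le> rank (A j)"
    by (simp add: W_def dim_mat_ran rank_transpose)
  then show "B \<in> rank_le k" using A by (auto simp: rank_le_def intro: order_trans)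
qed

text \<open>Orthogonal row spaces allow the two summands to be fed independently, so the column space of the
  sum is the sum of the column spaces, and orthogonality makes that sum direct.\<close>

lemma rank_add_orthogonal:
  fixes X Y :: "real^'n^'m"
  assumes "mat_ran Y \<subseteq> (mat_ran X)\<^sup>\<bottom>"
    and "mat_ran (transpose Y) \<subseteq> (mat_ran (transpose X))\<^sup>\<bottom>"
  shows "rank (X + Y) = rank X + rank Y"
proof -
  define V where "V = mat_ran (transpose X)"
  have sV: "subspace V" by (simp add: V_def subspace_mat_ran)
  have X0: "X *v v = 0" if "v \<in> V\<^sup>\<bottom>" for v
    using that mat_ran_transpose_orthogonal_comp[of v X] by (simp add: V_def)
  have "V \<subseteq> (mat_ran (transpose Y))\<^sup>\<bottom>"
    using assms(2) orthogonal_comp_subset[of V] orthogonal_comp_anti_mono[OF assms(2)]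
    by (auto simp: V_def)
  then have Y0: "Y *v v = 0" if "v \<in> V" for v
    using that mat_ran_transpose_orthogonal_comp[of v Y] by auto
  have XV: "X *v orth_proj V x = X *v x" for x
    using X0[OF orth_proj_diff[OF sV, of x]] by (simp add: matrix_vector_mult_diff_distrib)
  have YV: "Y *v orth_proj V x = 0" for x
    using Y0 orth_proj_mem[OF sV] by blast
  have "mat_ran (X + Y) = {x + y |x y. x \<in> mat_ran X \<and> y \<in> mat_ran Y}" (is "_ = ?S")
  proof
    show "mat_ran (X + Y) \<subseteq> ?S"
      by (force simp: mat_ran_def matrix_vector_mult_add_rdistrib)
    show "?S \<subseteq> mat_ran (X + Y)"
    proof
      fix z assume "z \<in> ?S"
      then obtain v w where z: "z = X *v v + Y *v w" by (auto simp: mat_ran_def)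
      \<comment> \<open>The part of the argument in the row space of \<open>X\<close> is seen by \<open>X\<close> only, the rest by \<open>Y\<close> only.\<close>
      have "(X + Y) *v (orth_proj V v + (w - orth_proj V w)) = z"
        by (simp add: z matrix_vector_mult_add_rdistrib matrix_vector_mult_diff_distrib
            matrix_vector_right_distrib XV YV)
      then show "z \<in> mat_ran (X + Y)" by (auto simp: mat_ran_def)
    qed
  qed
  moreover have "mat_ran X \<inter> mat_ran Y = {0}"
    using assms(1) subspace_0[OF subspace_mat_ran[of X]] subspace_0[OF subspace_mat_ran[of Y]]
      mem_orthogonal_comp_imp_0[of _ "mat_ran X"] by blast
  ultimately show ?thesis
    using dim_sums_Int[OF subspace_mat_ran[of X] subspace_mat_ran[of Y]]
    by (simp add: dim_mat_ran[symmetric])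
qed

section \<open>Projection onto the normal space\<close>

lemma orth_proj_matrix_idem:
  fixes S :: "(real^'n) set"
  assumes "subspace S"
  shows "matrix (orth_proj S) ** matrix (orth_proj S) = matrix (orth_proj S)"
proof -
  have "orth_proj S (orth_proj S x) = orth_proj S x" for x
    using orth_proj_mem[OF assms] subspace_0[OF subspace_orthogonal_comp[of S]]
    by (simp add: orth_proj_unique[OF assms])
  then show ?thesis
    by (simp add: matrix_eq matrix_vector_mul_assoc[symmetric] orth_proj_matrix_apply assms)
qed

lemma linear_tensor_proj: "linear (tensor_proj S T)"
  by (rule linearI) (simp_all add: tensor_proj_def matrix_add_rdistrib matrix_add_ldistrib
      matrix_scaleR_ldistrib matrix_scaleR_rdistrib)

lemmas tensor_proj_add = linear_add[OF linear_tensor_proj]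
  and tensor_proj_diff = linear_diff[OF linear_tensor_proj]
  and tensor_proj_scaleR = linear_scale[OF linear_tensor_proj]

lemma tensor_proj_idem:
  fixes S :: "(real^'m) set" and T :: "(real^'n) set"
  assumes "subspace S" and "subspace T"
  shows "tensor_proj S T (tensor_proj S T Z) = tensor_proj S T Z"
proof -
  define P Q where "P = matrix (orth_proj S)" and "Q = matrix (orth_proj T)"
  have "P ** (P ** Z ** Q) ** Q = (P ** P) ** Z ** (Q ** Q)"
    by (simp only: matrix_mul_assoc)
  then show ?thesis
    using assms by (simp add: tensor_proj_def P_def Q_def orth_proj_matrix_idem)
qed

lemma tensor_proj_self_adjoint:
  fixes S :: "(real^'m) set" and T :: "(real^'n) set"
  assumes "subspace S" and "subspace T"
  shows "tensor_proj S T A \<bullet> B = A \<bullet> tensor_proj S T B"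
proof -
  define P Q where "P = matrix (orth_proj S)" and "Q = matrix (orth_proj T)"
  have tr: "transpose P = P" "transpose Q = Q"
    using assms by (simp_all add: P_def Q_def orth_proj_matrix_transpose)
  have "tensor_proj S T A \<bullet> B = trace (Q ** (transpose A ** P ** B))"
    by (simp add: inner_eq_trace tensor_proj_def P_def[symmetric] Q_def[symmetric]
        matrix_transpose_mul tr matrix_mul_assoc)
  also have "\<dots> = trace ((transpose A ** P ** B) ** Q)" by (rule trace_mul_sym)
  also have "\<dots> = A \<bullet> tensor_proj S T B"
    by (simp add: inner_eq_trace tensor_proj_def P_def[symmetric] Q_def[symmetric] matrix_mul_assoc)
  finally show ?thesis .
qed

lemma tensor_proj_Pythagoras:
  fixes S :: "(real^'m) set" and T :: "(real^'n) set"
  assumes "subspace S" and "subspace T"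
  shows "(norm Z)\<^sup>2 = (norm (tensor_proj S T Z))\<^sup>2 + (norm (Z - tensor_proj S T Z))\<^sup>2"
proof -
  have "tensor_proj S T Z \<bullet> (Z - tensor_proj S T Z) = 0"
    by (simp add: tensor_proj_self_adjoint assms tensor_proj_diff tensor_proj_idem)
  then have "orthogonal (tensor_proj S T Z) (Z - tensor_proj S T Z)"
    by (simp add: orthogonal_def)
  from norm_add_Pythagorean[OF this] show ?thesis by simp
qed

lemma norm_tensor_proj_le:
  fixes S :: "(real^'m) set" and T :: "(real^'n) set"
  assumes "subspace S" and "subspace T"
  shows "norm (tensor_proj S T Z) \<le> norm Z"
proof (rule power2_le_imp_le)
  show "(norm (tensor_proj S T Z))\<^sup>2 \<le> (norm Z)\<^sup>2"
    using tensor_proj_Pythagoras[OF assms, of Z] by simp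
qed simp

lemma rank_tensor_proj_le: "rank (tensor_proj S T Z) \<le> rank Z"
  unfolding tensor_proj_def
  by (rule order_trans[OF rank_mul_le_left rank_mul_le_right])

lemma tensor_proj_mem_tensor_space:
  fixes S :: "(real^'m) set" and T :: "(real^'n) set"
  assumes "subspace S" and "subspace T"
  shows "tensor_proj S T Z \<in> S \<otimes>\<^sub>S T"
proof -
  define P Q where "P = matrix (orth_proj S)" and "Q = matrix (orth_proj T)"
  have tr: "transpose P = P" "transpose Q = Q"
    using assms by (simp_all add: P_def Q_def orth_proj_matrix_transpose)
  have S: "P *v x \<in> S" for x
    by (simp add: P_def assms orth_proj_matrix_apply orth_proj_mem)
  have T: "Q *v x \<in> T" for x
    by (simp add: Q_def assms orth_proj_matrix_apply orth_proj_mem)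
  have "tensor_proj S T Z = P ** (Z ** Q)" "transpose (tensor_proj S T Z) = Q ** (transpose Z ** P)"
    by (simp_all add: tensor_proj_def P_def[symmetric] Q_def[symmetric] matrix_transpose_mul tr
        matrix_mul_assoc)
  then have "tensor_proj S T Z *v x = P *v ((Z ** Q) *v x)"
    "transpose (tensor_proj S T Z) *v y = Q *v ((transpose Z ** P) *v y)" for x y
    by (simp_all only: matrix_vector_mul_assoc)
  with S T have "tensor_proj S T Z *v x \<in> S" "transpose (tensor_proj S T Z) *v y \<in> T" for x y
    by (simp_all only:)
  then show ?thesis unfolding tensor_space_def mat_ran_def by blast
qed

text \<open>The projection onto the orthogonal complement of the tangent space at \<open>X\<close>.\<close>

abbreviation normal_proj :: "real^'n^'m \<Rightarrow> real^'n^'m \<Rightarrow> real^'n^'m" where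
  "normal_proj X \<equiv> tensor_proj ((mat_ran X)\<^sup>\<bottom>) ((mat_ran (transpose X))\<^sup>\<bottom>)"

lemma normal_proj_idem [simp]: "normal_proj X (normal_proj X Z) = normal_proj X Z"
  by (intro tensor_proj_idem subspace_orthogonal_comp)

lemma normal_proj_self_adjoint: "normal_proj X Y \<bullet> Z = Y \<bullet> normal_proj X Z"
  by (intro tensor_proj_self_adjoint subspace_orthogonal_comp)

lemma normal_proj_Pythagoras:
  "(norm Z)\<^sup>2 = (norm (normal_proj X Z))\<^sup>2 + (norm (Z - normal_proj X Z))\<^sup>2"
  by (intro tensor_proj_Pythagoras subspace_orthogonal_comp)

lemma norm_normal_proj_le: "norm (normal_proj X Z) \<le> norm Z"
  by (intro norm_tensor_proj_le subspace_orthogonal_comp)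

lemma
  shows mat_ran_normal_proj: "mat_ran (normal_proj X Z) \<subseteq> (mat_ran X)\<^sup>\<bottom>"
    and mat_ran_transpose_normal_proj:
      "mat_ran (transpose (normal_proj X Z)) \<subseteq> (mat_ran (transpose X))\<^sup>\<bottom>"
proof -
  have "normal_proj X Z \<in> (mat_ran X)\<^sup>\<bottom> \<otimes>\<^sub>S (mat_ran (transpose X))\<^sup>\<bottom>"
    by (intro tensor_proj_mem_tensor_space subspace_orthogonal_comp)
  then show "mat_ran (normal_proj X Z) \<subseteq> (mat_ran X)\<^sup>\<bottom>"
    and "mat_ran (transpose (normal_proj X Z)) \<subseteq> (mat_ran (transpose X))\<^sup>\<bottom>"
    unfolding tensor_space_def by blast+
qed

lemma
  fixes X :: "real^'n^'m"
  shows proj_comp_range_mult: "matrix (orth_proj ((mat_ran X)\<^sup>\<bottom>)) ** X = 0"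
    and mult_proj_comp_row_space: "X ** matrix (orth_proj ((mat_ran (transpose X))\<^sup>\<bottom>)) = 0"
proof -
  have *: "Y ** matrix (orth_proj ((mat_ran (transpose Y))\<^sup>\<bottom>)) = 0" for Y :: "real^'p^'q"
  proof -
    have "Y *v orth_proj ((mat_ran (transpose Y))\<^sup>\<bottom>) x = 0" for x
      using orth_proj_mem[OF subspace_orthogonal_comp]
      by (rule mat_ran_transpose_orthogonal_comp[THEN iffD1])
    then show ?thesis
      by (simp add: matrix_eq matrix_vector_mul_assoc[symmetric] orth_proj_matrix_apply
          subspace_orthogonal_comp)
  qed
  show "X ** matrix (orth_proj ((mat_ran (transpose X))\<^sup>\<bottom>)) = 0" by (rule *)
  have "transpose (matrix (orth_proj ((mat_ran X)\<^sup>\<bottom>)) ** X) = 0"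
    using *[of "transpose X"]
    by (simp add: matrix_transpose_mul orth_proj_matrix_transpose subspace_orthogonal_comp)
  then show "matrix (orth_proj ((mat_ran X)\<^sup>\<bottom>)) ** X = 0"
    by (simp add: transpose_def vec_eq_iff)
qed

text \<open>A velocity \<open>A X + X B\<close> of a curve of constant rank is annihilated because \<open>\<Pi> X = 0\<close> for the
  projection \<open>\<Pi>\<close> onto \<open>U\<^sup>\<bottom>\<close>, and likewise on the right. Conversely, a vanishing normal part makes the
  bilinear form of \<open>Z\<close> vanish on \<open>U\<^sup>\<bottom> \<times> V\<^sup>\<bottom>\<close>.\<close>

lemma tangent_space_eq_kernel: "tangent_space X = {Z. normal_proj X Z = 0}"
proof (intro equalityI subsetI CollectI)
  fix Z assume "Z \<in> tangent_space X"
  then obtain A B where "Z = A ** X + X ** B" using tangent_space_imp_factor by blast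
  moreover have "normal_proj X (A ** X) = 0"
    using mult_proj_comp_row_space[of X]
    by (simp add: tensor_proj_def matrix_mul_assoc[symmetric])
  moreover have "normal_proj X (X ** B) = 0"
    using proj_comp_range_mult[of X] by (simp add: tensor_proj_def matrix_mul_assoc)
  ultimately show "normal_proj X Z = 0" by (simp add: tensor_proj_add)
next
  fix Z assume "Z \<in> {Z. normal_proj X Z = 0}"
  then have 0: "normal_proj X Z = 0" by simp
  define S T where "S = (mat_ran X)\<^sup>\<bottom>" and "T = (mat_ran (transpose X))\<^sup>\<bottom>"
  have s: "subspace S" "subspace T" by (simp_all add: S_def T_def subspace_orthogonal_comp)
  have fix_mem: "orth_proj R x = x" if "x \<in> R" "subspace R" for R :: "(real^'z) set" and x
    using that subspace_0[OF subspace_orthogonal_comp[of R]] by (simp add: orth_proj_unique)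
  show "Z \<in> tangent_space X"
  proof (rule bilinear_zero_imp_tangent_space)
    fix u v assume u: "u \<in> (mat_ran X)\<^sup>\<bottom>" and v: "v \<in> (mat_ran (transpose X))\<^sup>\<bottom>"
    have "u \<bullet> (Z *v v) = orth_proj S u \<bullet> (Z *v orth_proj T v)"
      using u v s by (simp add: fix_mem S_def T_def)
    also have "\<dots> = u \<bullet> (normal_proj X Z *v v)"
      using s by (simp add: tensor_proj_def S_def[symmetric] T_def[symmetric]
          matrix_vector_mul_assoc[symmetric] orth_proj_matrix_apply orth_proj_self_adjoint)
    finally show "u \<bullet> (Z *v v) = 0" by (simp add: 0)
  qed
qed

lemma orth_proj_tangent_space: "orth_proj (tangent_space X) Z = Z - normal_proj X Z"
proof -
  have "subspace (tangent_space X)"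
    unfolding tangent_space_eq_kernel
    by (rule linear_subspace_kernel[OF linear_tensor_proj])
  moreover have "Z - normal_proj X Z \<in> tangent_space X"
    by (simp add: tangent_space_eq_kernel tensor_proj_diff)
  moreover have "normal_proj X Z \<in> (tangent_space X)\<^sup>\<bottom>"
    unfolding orthogonal_comp_def[of "tangent_space X"] orthogonal_def
    by (simp add: tangent_space_eq_kernel normal_proj_self_adjoint[symmetric])
  ultimately show ?thesis by (simp add: orth_proj_unique)
qed

section \<open>The tangent cone of the matrices of bounded rank\<close>

text \<open>Let \<open>P\<close> and \<open>Q\<close> project onto \<open>U\<^sup>\<bottom>\<close> and \<open>V\<^sup>\<bottom>\<close>, let \<open>Y\<^sub>j \<rightarrow> X\<close> have rank at most \<open>k\<close>, and let
  \<open>a\<^sub>j (Y\<^sub>j - X) \<rightarrow> G\<close>. Stretch \<open>Y\<^sub>j\<close> by \<open>\<surd>a\<^sub>j\<close> along \<open>U\<^sup>\<bottom>\<close> on the left and along \<open>V\<^sup>\<bottom>\<close> on the right.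
  Neither operation raises the rank. The block of \<open>Y\<^sub>j\<close> in \<open>U\<^sup>\<bottom> \<otimes> V\<^sup>\<bottom>\<close> is multiplied by \<open>a\<^sub>j\<close> and
  converges to \<open>P G Q\<close>; the two mixed blocks are multiplied by \<open>\<surd>a\<^sub>j\<close> only and vanish in the limit;
  the block in \<open>U \<otimes> V\<close> converges to \<open>X\<close>. Hence \<open>X + P G Q\<close>, whose rank is \<open>rank X + rank (P G Q)\<close>, is a
  limit of matrices of rank at most \<open>k\<close>.\<close>

lemma tangent_cone_imp_rank_normal_proj:
  fixes X :: "real^'n^'m"
  assumes "G \<in> tangent_cone (rank_le k) X"
  shows "rank X + rank (normal_proj X G) \<le> k"
proof -
  obtain Y :: "nat \<Rightarrow> real^'n^'m" and a where Y: "\<And>j. Y j \<in> rank_le k" and a: "\<And>j. a j > 0"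
    and lim: "Y \<longlonglongrightarrow> X" and limG: "(\<lambda>j. a j *\<^sub>R (Y j - X)) \<longlonglongrightarrow> G"
    using assms by (auto simp: tangent_cone_def)
  define P Q where "P = matrix (orth_proj ((mat_ran X)\<^sup>\<bottom>))"
    and "Q = matrix (orth_proj ((mat_ran (transpose X))\<^sup>\<bottom>))"
  define E where "E j = Y j - X" for j
  define b where "b j = sqrt (a j)" for j
  have b2: "b j * b j = a j" for j using a[of j] by (simp add: b_def)
  have PX: "P ** X = 0" "X ** Q = 0"
    by (simp_all add: P_def Q_def proj_comp_range_mult mult_proj_comp_row_space)
  have E0: "E \<longlonglongrightarrow> 0" unfolding E_def using lim by (simp add: LIM_zero)
  have aE: "(\<lambda>j. a j *\<^sub>R E j) \<longlonglongrightarrow> G" using limG by (simp add: E_def)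
  \<comment> \<open>The norm of \<open>b j *\<^sub>R E j\<close> is the geometric mean of those of \<open>a j *\<^sub>R E j\<close>, which is bounded, and of
    \<open>E j\<close>, which tends to zero.\<close>
  have bE: "(\<lambda>j. b j *\<^sub>R E j) \<longlonglongrightarrow> 0"
  proof -
    have "(\<lambda>j. sqrt (norm (a j *\<^sub>R E j) * norm (E j))) \<longlonglongrightarrow> sqrt (norm G * norm (0 :: real^'n^'m))"
      by (intro tendsto_intros aE E0)
    moreover have "sqrt (norm (a j *\<^sub>R E j) * norm (E j)) = norm (b j *\<^sub>R E j)" for j
      using a[of j] by (simp add: b_def real_sqrt_mult)
    ultimately have "(\<lambda>j. norm (b j *\<^sub>R E j)) \<longlonglongrightarrow> 0"
      by (simp only: norm_zero mult_zero_right real_sqrt_zero)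
    then show ?thesis by (rule tendsto_norm_zero_cancel)
  qed
  define M where "M j = (mat 1 + (b j - 1) *\<^sub>R P) ** Y j ** (mat 1 + (b j - 1) *\<^sub>R Q)" for j
  have M: "M j = X + (E j - P ** E j - E j ** Q + P ** E j ** Q)
      + (P ** (b j *\<^sub>R E j) + (b j *\<^sub>R E j) ** Q - 2 *\<^sub>R (P ** (b j *\<^sub>R E j) ** Q))
      + P ** (a j *\<^sub>R E j) ** Q" for j
  proof -
    have "(mat 1 + c *\<^sub>R P) ** (X + E j) ** (mat 1 + c *\<^sub>R Q)
        = X + E j + c *\<^sub>R (P ** E j) + c *\<^sub>R (E j ** Q) + (c * c) *\<^sub>R (P ** E j ** Q)" for c
      by (simp add: matrix_add_ldistrib matrix_add_rdistrib matrix_scaleR_ldistrib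
          matrix_scaleR_rdistrib PX scaleR_add_right)
    moreover have "Y j = X + E j" by (simp add: E_def)
    ultimately have "M j = X + E j + (b j - 1) *\<^sub>R (P ** E j) + (b j - 1) *\<^sub>R (E j ** Q)
        + ((b j - 1) * (b j - 1)) *\<^sub>R (P ** E j ** Q)"
      by (simp only: M_def)
    then show ?thesis
      unfolding b2[symmetric]
      by (simp add: matrix_scaleR_ldistrib matrix_scaleR_rdistrib algebra_simps)
  qed
  have "M \<longlonglongrightarrow> X + (0 - P ** 0 - 0 ** Q + P ** 0 ** Q)
      + (P ** 0 + 0 ** Q - 2 *\<^sub>R (P ** 0 ** Q)) + P ** G ** Q"
    unfolding M by (intro tendsto_intros E0 bE aE)
  then have "M \<longlonglongrightarrow> X + normal_proj X G"
    by (simp add: tensor_proj_def P_def Q_def)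
  moreover have "M j \<in> rank_le k" for j
  proof -
    have "rank (M j) \<le> rank (Y j)"
      unfolding M_def by (rule order_trans[OF rank_mul_le_left rank_mul_le_right])
    then show ?thesis using Y[of j] by (simp add: rank_le_def)
  qed
  ultimately have "X + normal_proj X G \<in> rank_le k"
    using closed_rank_le closed_sequentially by blast
  moreover have "rank (X + normal_proj X G) = rank X + rank (normal_proj X G)"
    by (intro rank_add_orthogonal mat_ran_normal_proj mat_ran_transpose_normal_proj)
  ultimately show ?thesis by (simp add: rank_le_def)
qed

text \<open>The tangential part \<open>A X + X B\<close> is the velocity of the curve \<open>(1 + t A) X (1 + t B)\<close>, whose rank
  never exceeds \<open>rank X\<close>. Adding \<open>t\<close> times the normal part costs at most the rank of the latter.\<close>

lemma rank_normal_proj_imp_tangent_cone: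
  fixes X :: "real^'n^'m"
  assumes "rank X + rank (normal_proj X G) \<le> k"
  shows "G \<in> tangent_cone (rank_le k) X"
proof -
  define N where "N = normal_proj X G"
  have "G - N \<in> tangent_space X"
    by (simp add: N_def tangent_space_eq_kernel tensor_proj_diff)
  then obtain A B where AB: "G = A ** X + X ** B + N"
    using tangent_space_imp_factor by (metis diff_add_cancel)
  define t where "t j = inverse (real (Suc j))" for j
  have t: "t \<longlonglongrightarrow> 0" unfolding t_def by (rule LIMSEQ_inverse_real_of_nat)
  have tpos: "t j > 0" for j by (simp add: t_def)
  define Y where "Y j = (mat 1 + t j *\<^sub>R A) ** X ** (mat 1 + t j *\<^sub>R B) + t j *\<^sub>R N" for j
  have Y: "Y j = X + t j *\<^sub>R (G + t j *\<^sub>R (A ** X ** B))" for j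
    by (simp add: Y_def AB matrix_add_ldistrib matrix_add_rdistrib matrix_scaleR_ldistrib
        matrix_scaleR_rdistrib algebra_simps matrix_mul_assoc)
  have "Y j \<in> rank_le k" for j
  proof -
    have "rank (Y j) \<le> rank ((mat 1 + t j *\<^sub>R A) ** X ** (mat 1 + t j *\<^sub>R B)) + rank (t j *\<^sub>R N)"
      unfolding Y_def by (rule rank_add_le)
    also have "\<dots> \<le> rank X + rank N"
      by (intro add_mono rank_scaleR_le) (rule order_trans[OF rank_mul_le_left rank_mul_le_right])
    finally show ?thesis using assms by (simp add: rank_le_def N_def)
  qed
  moreover have "Y \<longlonglongrightarrow> X + 0 *\<^sub>R (G + 0 *\<^sub>R (A ** X ** B))"
    unfolding Y by (intro tendsto_intros t)
  moreover have "(\<lambda>j. inverse (t j) *\<^sub>R (Y j - X)) \<longlonglongrightarrow> G + 0 *\<^sub>R (A ** X ** B)"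
  proof -
    have "inverse (t j) *\<^sub>R (Y j - X) = G + t j *\<^sub>R (A ** X ** B)" for j
      using tpos[of j] by (simp add: Y)
    then show ?thesis by (simp only:) (intro tendsto_intros t)
  qed
  ultimately show ?thesis
    unfolding tangent_cone_def using tpos
    by (intro CollectI exI[of _ Y] exI[of _ "\<lambda>j. inverse (t j)"]) simp
qed

lemma tangent_cone_rank_le:
  "tangent_cone (rank_le k) X = {G. rank X + rank (normal_proj X G) \<le> k}"
  using tangent_cone_imp_rank_normal_proj rank_normal_proj_imp_tangent_cone by blast

section \<open>Low-rank approximation by selecting columns\<close>

text \<open>Deleting a least element never lowers the average.\<close>

lemma ex_subset_sum_ge_average:
  fixes w :: "'a \<Rightarrow> real"
  assumes "finite B" and "r \<le> card B"
  shows "\<exists>J\<subseteq>B. card J = r \<and> real r * sum w B \<le> real (card B) * sum w J"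
  using assms
proof (induction "card B - r" arbitrary: B)
  case 0
  then show ?case by (intro exI[of _ B]) auto
next
  case (Suc d)
  then have ne: "B \<noteq> {}" by auto
  obtain b where b: "b \<in> B" "\<And>x. x \<in> B \<Longrightarrow> w b \<le> w x"
    using ex_min_if_finite[of "w ` B"] Suc.prems(1) ne by (auto simp: not_less)
  define C where "C = B - {b}"
  have C: "finite C" "card B = Suc (card C)" "sum w B = w b + sum w C"
    using Suc.prems(1) card.remove[OF Suc.prems(1) b(1)] sum.remove[OF Suc.prems(1) b(1), of w]
    by (simp_all add: C_def)
  obtain J where J: "J \<subseteq> C" "card J = r" "real r * sum w C \<le> real (card C) * sum w J"
  proof -
    have "d = card C - r" "r \<le> card C" using Suc.hyps(2) C(2) by linarith+
    then show ?thesis using Suc.hyps(1)[OF _ C(1)] that by blast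
  qed
  have "real r * w b \<le> sum w J"
    using sum_bounded_below[of J "w b" w] J b(2) by (auto simp: C_def)
  then have "real r * sum w B \<le> real (card B) * sum w J"
    using J(3) by (simp add: C algebra_simps)
  then show ?case using J by (intro exI[of _ J]) (auto simp: C_def)
qed

lemma norm_sum_orthonormal:
  fixes B :: "'a::real_inner set"
  assumes "finite B" and "pairwise orthogonal B" and "\<And>b. b \<in> B \<Longrightarrow> norm b = 1"
  shows "(norm (\<Sum>b\<in>B. c b *\<^sub>R b))\<^sup>2 = (\<Sum>b\<in>B. (c b)\<^sup>2)"
proof -
  have "pairwise (\<lambda>i j. orthogonal (c i *\<^sub>R i) (c j *\<^sub>R j)) B"
    using assms(2) by (auto simp: pairwise_def orthogonal_def)
  from norm_sum_Pythagorean[OF assms(1) this] show ?thesis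
    using assms(3) by (simp add: power_mult_distrib)
qed

text \<open>With respect to an orthonormal basis \<open>B\<close> of \<open>S\<close>, the matrix \<open>A\<close> has the columns \<open>A b\<close> for \<open>b \<in> B\<close>,
  and its squared norm is the sum of their squared norms. The approximation \<open>Y\<close> keeps \<open>r\<close>
  columns whose mean squared norm is at least that of all columns.\<close>

lemma ex_low_rank_approx_row_space:
  fixes A :: "real^'n^'m"
  assumes "subspace S" and row: "mat_ran (transpose A) \<subseteq> S" and r: "r \<le> dim S"
  shows "\<exists>Y. rank Y \<le> r \<and> real (dim S) * (norm (A - Y))\<^sup>2 \<le> (real (dim S) - real r) * (norm A)\<^sup>2"
proof -
  obtain B where B: "pairwise orthogonal B" "\<And>b. b \<in> B \<Longrightarrow> norm b = 1" "independent B"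
    "card B = dim S" "span B = S"
    using orthonormal_basis_subspace[OF assms(1)] by metis
  have fin: "finite B" using B(3) by (simp add: independent_imp_finite)
  have norm_sum: "(\<Sum>i\<in>UNIV. (norm (\<Sum>b\<in>C. (A $ i \<bullet> b) *\<^sub>R b))\<^sup>2) = (\<Sum>b\<in>C. (norm (A *v b))\<^sup>2)"
    if "C \<subseteq> B" for C
  proof -
    have "(norm (\<Sum>b\<in>C. (A $ i \<bullet> b) *\<^sub>R b))\<^sup>2 = (\<Sum>b\<in>C. (A $ i \<bullet> b)\<^sup>2)" for i
      using that B(1,2) by (intro norm_sum_orthonormal)
        (auto intro: finite_subset[OF _ fin] pairwise_mono)
    moreover have "(norm (A *v b))\<^sup>2 = (\<Sum>i\<in>UNIV. (A $ i \<bullet> b)\<^sup>2)" for b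
      by (simp add: norm_vec_def L2_set_def sum_nonneg matrix_vector_mul_component)
    ultimately show ?thesis by (simp add: sum.swap[of _ C])
  qed
  have norm_mat: "(norm M)\<^sup>2 = (\<Sum>i\<in>UNIV. (norm (M $ i))\<^sup>2)" for M :: "real^'n^'m"
    by (simp add: norm_vec_def[of M] L2_set_def sum_nonneg)
  have exp: "(\<Sum>b\<in>B. (A $ i \<bullet> b) *\<^sub>R b) = A $ i" for i
  proof (rule orthonormal_basis_expand[OF B(1,2)])
    have "A $ i = transpose A *v axis i 1"
      by (simp add: matrix_vector_mult_basis column_def transpose_def vec_eq_iff)
    then show "A $ i \<in> span B" using row B(5) by (auto simp: mat_ran_def)
  qed (use fin in auto)
  obtain J where J: "J \<subseteq> B" "card J = r"
    "real r * (\<Sum>b\<in>B. (norm (A *v b))\<^sup>2) \<le> real (card B) * (\<Sum>b\<in>J. (norm (A *v b))\<^sup>2)"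
    using ex_subset_sum_ge_average[OF fin, of r "\<lambda>b. (norm (A *v b))\<^sup>2"] r B(4) by auto
  define Y :: "real^'n^'m" where "Y = (\<chi> i. \<Sum>b\<in>J. (A $ i \<bullet> b) *\<^sub>R b)"
  have finJ: "finite J" using J(1) fin by (rule finite_subset)
  have "row i Y = (\<Sum>b\<in>J. (A $ i \<bullet> b) *\<^sub>R b)" for i
    by (simp add: row_def Y_def vec_eq_iff)
  then have "rows Y \<subseteq> span J"
    by (auto simp: rows_def intro: span_sum span_scale span_base)
  then have "rank Y \<le> r"
    using dim_le_card[OF _ finJ] J(2) by (simp add: row_rank_def)
  moreover have "(A - Y) $ i = (\<Sum>b\<in>B - J. (A $ i \<bullet> b) *\<^sub>R b)" for i
    using exp[of i] sum.subset_diff[OF J(1) fin, of "\<lambda>b. (A $ i \<bullet> b) *\<^sub>R b"]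
    by (simp add: Y_def algebra_simps)
  then have "(norm (A - Y))\<^sup>2 = (\<Sum>b\<in>B - J. (norm (A *v b))\<^sup>2)"
    using norm_sum[of "B - J"] by (simp add: norm_mat[of "A - Y"])
  moreover have nA: "(norm A)\<^sup>2 = (\<Sum>b\<in>B. (norm (A *v b))\<^sup>2)"
    using norm_sum[of B] by (simp add: norm_mat[of A] exp)
  ultimately show ?thesis
    using J(3) B(4) sum.subset_diff[OF J(1) fin, of "\<lambda>b. (norm (A *v b))\<^sup>2"]
    by (intro exI[of _ Y]) (simp add: algebra_simps)
qed

lemma ex_low_rank_approx_column_space:
  fixes A :: "real^'n^'m"
  assumes "subspace S" and "mat_ran A \<subseteq> S" and "r \<le> dim S"
  shows "\<exists>Y. rank Y \<le> r \<and> real (dim S) * (norm (A - Y))\<^sup>2 \<le> (real (dim S) - real r) * (norm A)\<^sup>2"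
proof -
  obtain Y where Y: "rank Y \<le> r"
    "real (dim S) * (norm (transpose A - Y))\<^sup>2 \<le> (real (dim S) - real r) * (norm (transpose A))\<^sup>2"
    using ex_low_rank_approx_row_space[OF assms(1) _ assms(3), of "transpose A"] assms(2) by auto
  have "transpose (A - transpose Y) = transpose A - Y"
    by (simp add: transpose_def vec_eq_iff)
  then have "norm (A - transpose Y) = norm (transpose A - Y)"
    by (metis norm_transpose)
  with Y show ?thesis
    by (intro exI[of _ "transpose Y"]) (simp add: rank_transpose norm_transpose)
qed

section \<open>Projection onto the tangent cone\<close>

text \<open>The tangential part of \<open>Z\<close> and the normal part of \<open>Y\<close> add up to a point of the cone. The normal
  part of \<open>Y\<close> has no larger rank than \<open>Y\<close>, and it is at least as close to the normal part of \<open>Z\<close>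
  because the projection contracts distances.\<close>

lemma tangent_cone_approx:
  fixes X Y Z :: "real^'n^'m"
  assumes "rank X + rank Y \<le> k"
  shows "infdist Z (tangent_cone (rank_le k) X) \<le> norm (normal_proj X Z - Y)"
proof -
  let ?G = "Z - normal_proj X Z + normal_proj X Y"
  have "normal_proj X ?G = normal_proj X Y" by (simp add: tensor_proj_add tensor_proj_diff)
  then have "?G \<in> tangent_cone (rank_le k) X"
    using assms add_left_mono[OF rank_tensor_proj_le[of _ _ Y], of "rank X"]
    by (simp only: tangent_cone_rank_le mem_Collect_eq) (rule order_trans, assumption+)
  then have "infdist Z (tangent_cone (rank_le k) X) \<le> dist Z ?G" by (rule infdist_le)
  also have "\<dots> = norm (normal_proj X (normal_proj X Z - Y))"
    by (simp add: dist_norm tensor_proj_diff algebra_simps)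
  also have "\<dots> \<le> norm (normal_proj X Z - Y)" by (rule norm_normal_proj_le)
  finally show ?thesis .
qed

lemma tangent_cone_projection:
  fixes X G Z :: "real^'n^'m"
  assumes rk: "rank X \<le> k"
    and G: "G \<in> tangent_cone (rank_le k) X"
    and min: "norm (Z - G) = infdist Z (tangent_cone (rank_le k) X)"
  shows "best_rank_approx (k - rank X) (normal_proj X Z) (normal_proj X G)" (is ?best)
    and "G = Z - normal_proj X Z + normal_proj X G" (is ?split)
    and "(norm Z)\<^sup>2 - (infdist Z (tangent_cone (rank_le k) X))\<^sup>2 = (norm G)\<^sup>2" (is ?norm)
proof -
  let ?N = "normal_proj X" and ?C = "tangent_cone (rank_le k) X"
  have rG: "rank X + rank (?N G) \<le> k" using G by (simp add: tangent_cone_rank_le)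
  \<comment> \<open>\<open>Z - G\<close> has no tangential part: replacing that of \<open>G\<close> by that of \<open>Z\<close> would otherwise bring \<open>G\<close>
    closer to \<open>Z\<close> within the cone.\<close>
  have "norm (Z - G) \<le> norm (?N (Z - G))"
    using tangent_cone_approx[OF rG, of Z] min by (simp add: tensor_proj_diff)
  then have "(norm (Z - G))\<^sup>2 \<le> (norm (?N (Z - G)))\<^sup>2" by (rule power_mono) simp
  then have "(norm (Z - G - ?N (Z - G)))\<^sup>2 \<le> 0"
    using normal_proj_Pythagoras[of "Z - G" X] by linarith
  then have ZG: "Z - G = ?N Z - ?N G" by (simp add: tensor_proj_diff)
  then show ?split by (simp add: algebra_simps)
  show ?best
    unfolding best_rank_approx_def
  proof (intro conjI ballI)
    show "?N G \<in> rank_le (k - rank X)" using rG by (simp add: rank_le_def)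
    fix Y :: "real^'n^'m" assume "Y \<in> rank_le (k - rank X)"
    then have "rank X + rank Y \<le> k" using rk by (simp add: rank_le_def)
    from tangent_cone_approx[OF this, of Z] show "norm (?N Z - ?N G) \<le> norm (?N Z - Y)"
      using min ZG by simp
  qed
  \<comment> \<open>The cone contains the line through \<open>G\<close>, on which \<open>G\<close> is then the closest point to \<open>Z\<close>.\<close>
  have "c *\<^sub>R G \<in> ?C" for c
    using rG rank_scaleR_le[of c "?N G"] by (simp add: tangent_cone_rank_le tensor_proj_scaleR)
  then have close: "\<forall>y\<in>span {G}. dist Z G \<le> dist Z y"
    using min infdist_le[of _ ?C Z] by (auto simp: span_singleton dist_norm[of Z G])
  have le: "(Z - G) \<bullet> (y - G) \<le> 0" if "y \<in> span {G}" for y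
    by (rule any_closest_point_dot[OF _ _ _ that close])
      (auto simp: subspace_imp_convex closed_subspace span_base)
  have "(Z - G) \<bullet> G = 0"
    using le[OF span_0] le[OF span_add[OF span_base span_base, of G _ G]] by simp
  then have "orthogonal G (Z - G)" by (simp add: orthogonal_def inner_commute)
  from norm_add_Pythagorean[OF this] show ?norm by (simp add: min[symmetric])
qed

text \<open>The spaces \<open>U\<^sup>\<bottom>\<close> and \<open>V\<^sup>\<bottom>\<close> have dimensions \<open>m - s\<close> and \<open>n - s\<close>; columns or rows of the normal part
  are selected in the space of smaller dimension.\<close>

lemma infdist_tangent_cone_le:
  fixes X Z :: "real^'n^'m"
  assumes rk: "rank X \<le> k" and k: "k \<le> min CARD('m) CARD('n)"
  shows "(infdist Z (tangent_cone (rank_le k) X))\<^sup>2 \<le>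
     (1 - (real k - real (rank X)) / min (real CARD('m) - real (rank X)) (real CARD('n) - real (rank X)))
       * (norm Z)\<^sup>2"
proof -
  let ?U = "(mat_ran X)\<^sup>\<bottom>" and ?V = "(mat_ran (transpose X))\<^sup>\<bottom>" and ?A = "normal_proj X Z"
  define d where "d = min (dim ?U) (dim ?V)"
  have dU: "dim ?U + rank X = CARD('m)" and dV: "dim ?V + rank X = CARD('n)"
    using dim_orthogonal_comp[OF subspace_mat_ran[of X]]
      dim_orthogonal_comp[OF subspace_mat_ran[of "transpose X"]]
    by (simp_all add: dim_mat_ran rank_transpose)
  then have d: "real d = min (real CARD('m) - real (rank X)) (real CARD('n) - real (rank X))"
    by (auto simp: d_def min_def)
  have rd: "k - rank X \<le> dim ?U" "k - rank X \<le> dim ?V" using dU dV k by auto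
  obtain Y where Y: "rank Y \<le> k - rank X"
    "real d * (norm (?A - Y))\<^sup>2 \<le> (real d - real (k - rank X)) * (norm ?A)\<^sup>2"
  proof (cases "dim ?U \<le> dim ?V")
    case True
    then have "d = dim ?U" by (simp add: d_def)
    then show ?thesis
      using ex_low_rank_approx_column_space[OF subspace_orthogonal_comp mat_ran_normal_proj rd(1)] that
      by blast
  next
    case False
    then have "d = dim ?V" by (simp add: d_def)
    then show ?thesis
      using ex_low_rank_approx_row_space[OF subspace_orthogonal_comp mat_ran_transpose_normal_proj rd(2)]
        that
      by blast
  qed
  have le: "norm ?A \<le> norm Z" by (rule norm_normal_proj_le)
  have dist: "infdist Z (tangent_cone (rank_le k) X) \<le> norm (?A - W)" if "rank W \<le> k - rank X" for W
    using that rk by (intro tangent_cone_approx) simp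
  have "(infdist Z (tangent_cone (rank_le k) X))\<^sup>2 \<le> (1 - real (k - rank X) / real d) * (norm Z)\<^sup>2"
  proof (cases "d = 0")
    case True
    \<comment> \<open>Here \<open>X\<close> has full rank and the quotient, as a division by zero, is \<open>0\<close>.\<close>
    have "infdist Z (tangent_cone (rank_le k) X) \<le> norm Z" using dist[of 0] le by simp
    then show ?thesis using True by (simp add: infdist_nonneg power_mono)
  next
    case False
    have "(infdist Z (tangent_cone (rank_le k) X))\<^sup>2 \<le> (norm (?A - Y))\<^sup>2"
      using dist[OF Y(1)] by (intro power_mono) (auto simp: infdist_nonneg)
    also have "\<dots> \<le> (1 - real (k - rank X) / real d) * (norm ?A)\<^sup>2"
      using Y(2) False by (simp add: field_simps)
    also have "\<dots> \<le> (1 - real (k - rank X) / real d) * (norm Z)\<^sup>2"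
      using le rd False by (intro mult_left_mono power_mono) (auto simp: d_def field_simps)
    finally show ?thesis .
  qed
  then show ?thesis using rk by (simp add: d of_nat_diff)
qed

theorem corollary3p3:
  fixes f :: "real^'n^'m \<Rightarrow> real"
    and grad :: "real^'n^'m \<Rightarrow> real^'n^'m"
    and D :: "(real^'n^'m) set"
    and X :: "real^'n^'m"
    and k s :: nat
    and U :: "(real^'m) set" and V :: "(real^'n) set"
  assumes k: "k \<le> min CARD('m) CARD('n)"
    and D: "open D" "rank_le k \<subseteq> D"
    and grad: "\<And>Y. Y \<in> D \<Longrightarrow> GDERIV f Y :> grad Y"
    and grad_cont: "continuous_on D grad"
    and f_bdd: "bdd_below (f ` D)"
    and X: "X \<in> rank_le k" "rank X = s"
    and U: "U = mat_ran X"
    and V: "V = mat_ran (transpose X)"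
  shows "(\<forall>G \<in> tangent_cone (rank_le k) X.
            norm (- grad X - G) = infdist (- grad X) (tangent_cone (rank_le k) X) \<longrightarrow>
              (\<exists>\<Xi>. best_rank_approx (k - s) (tensor_proj (U\<^sup>\<bottom>) (V\<^sup>\<bottom>) (- grad X)) \<Xi> \<and>
                   G = orth_proj (tangent_space X) (- grad X) + \<Xi>) \<and>
              gminus k grad X = norm G)
         \<and> tensor_proj (U\<^sup>\<bottom>) (V\<^sup>\<bottom>) (- grad X) = - grad X - orth_proj (tangent_space X) (- grad X)
         \<and> gminus k grad X \<ge>
              sqrt ((real k - real s) / min (real CARD('m) - real s) (real CARD('n) - real s))
                * norm (grad X)"
proof (intro conjI ballI impI)
  let ?C = "tangent_cone (rank_le k) X" and ?Z = "- grad X"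
  have rk: "rank X \<le> k" using X(1) by (simp add: rank_le_def)
  show "tensor_proj (U\<^sup>\<bottom>) (V\<^sup>\<bottom>) ?Z = ?Z - orth_proj (tangent_space X) ?Z"
    by (simp add: U V orth_proj_tangent_space)
  show "sqrt ((real k - real s) / min (real CARD('m) - real s) (real CARD('n) - real s))
      * norm (grad X) \<le> gminus k grad X"
  proof -
    let ?c = "(real k - real s) / min (real CARD('m) - real s) (real CARD('n) - real s)"
    have "sqrt ?c * norm (grad X) = sqrt (?c * (norm (grad X))\<^sup>2)" by (simp only: real_sqrt_mult) simp
    also have "\<dots> \<le> gminus k grad X"
      unfolding gminus_def using infdist_tangent_cone_le[OF rk k, of ?Z] X(2)
      by (intro real_sqrt_le_mono) (simp add: left_diff_distrib)
    finally show ?thesis .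
  qed
  fix G assume G: "G \<in> ?C" "norm (?Z - G) = infdist ?Z ?C"
  note proj = tangent_cone_projection[OF rk G]
  show "\<exists>\<Xi>. best_rank_approx (k - s) (tensor_proj (U\<^sup>\<bottom>) (V\<^sup>\<bottom>) ?Z) \<Xi> \<and>
      G = orth_proj (tangent_space X) ?Z + \<Xi>"
    using proj(1,2) X(2) by (intro exI[of _ "normal_proj X G"]) (simp add: U V orth_proj_tangent_space)
  show "gminus k grad X = norm G"
    using proj(3) by (simp add: gminus_def)
qed

end
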